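(* Let $n$ be a positive integer and let $f : [0,1]^n \to [0,1]$ be a McNaughton function, that is, $f$ is continuous with respect to the natural topology of $[0,1]^n$, and there are finitely many linear polynomials $g_1, \ldots, g_k$ in $n$ variables with integer coefficients such that for each point $x \in [0,1]^n$ there is an index $j \in \{1, \ldots, k\}$ with $f(x) = g_j(x)$. Then there is an element $a \in F_n$, where $F_n$ is the free MV-algebra on $n$ generators (the algebra of MV-terms in $n$ variables), such that $f = f_a$, where $f_a : [0,1]^n \to [0,1]$ is the term function corresponding to $a$.
   Context: An MV-algebra is a structure $(A, \oplus, \neg, 0)$ such that $(A,\oplus,0)$ is a commutative monoid, $\neg\neg x = x$, $x \oplus \neg 0 = \neg 0$, and $\neg(\neg x \oplus y) \oplus y = \neg(\neg y \oplus x) \oplus x$ for all $x,y \in A$. The unit interval $[0,1]$ is an MV-algebra with $x \oplus y = \min(1, x+y)$ and $\neg x = 1 - x$. A "linear polynomial in $n$ variables with integer coefficients" is a function of the form $g(x_1,\ldots,x_n) = c_0 + c_1 x_1 + \cdots + c_n x_n$ with $c_0, c_1, \ldots, c_n \in \mathbb{Z}$ (a constant term is allowed). MV-terms in the variables $X_1, \ldots, X_n$ are built from $X_1,\ldots,X_n$ and the constant $0$ using the unary operation $\neg$ and the binary operation $\oplus$. $F_n$ denotes the free MV-algebra on the $n$ generators $X_1, \ldots, X_n$, i.e. MV-terms in these variables modulo the identities holding in all MV-algebras. The term function $f_a : [0,1]^n \to [0,1]$ of $a$ is obtained by evaluating a term representing $a$ in the MV-algebra $[0,1]$: $f_{X_i}(x_1,\ldots,x_n)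 = x_i$, $f_0 = 0$, $f_{\neg a} = 1 - f_a$, $f_{a \oplus b} = \min(1, f_a + f_b)$. It depends only on the class of the term in $F_n$. *)

theory Defs
  imports "HOL-Analysis.Analysis"
begin

section \<open>MV-algebras\<close>

locale mv_algebra =
  fixes A :: "'a set"
    and oplus :: "'a \<Rightarrow> 'a \<Rightarrow> 'a"
    and neg :: "'a \<Rightarrow> 'a"
    and zero :: 'a
  assumes oplus_closed: "\<lbrakk>x \<in> A; y \<in> A\<rbrakk> \<Longrightarrow> oplus x y \<in> A"
    and neg_closed: "x \<in> A \<Longrightarrow> neg x \<in> A"
    and zero_closed: "zero \<in> A"
    and oplus_assoc: "\<lbrakk>x \<in> A; y \<in> A; z \<in> A\<rbrakk> \<Longrightarrow> oplus (oplus x y) z = oplus x (oplus y z)"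
    and oplus_comm: "\<lbrakk>x \<in> A; y \<in> A\<rbrakk> \<Longrightarrow> oplus x y = oplus y x"
    and oplus_zero: "x \<in> A \<Longrightarrow> oplus x zero = x"
    and neg_neg: "x \<in> A \<Longrightarrow> neg (neg x) = x"
    and oplus_neg_zero: "x \<in> A \<Longrightarrow> oplus x (neg zero) = neg zero"
    and lukasiewicz: "\<lbrakk>x \<in> A; y \<in> A\<rbrakk> \<Longrightarrow>
          oplus (neg (oplus (neg x) y)) y = oplus (neg (oplus (neg y) x)) x"

definition unit_oplus :: "real \<Rightarrow> real \<Rightarrow> real" where
  "unit_oplus x y = min 1 (x + y)"

definition unit_neg :: "real \<Rightarrow> real" where
  "unit_neg x = 1 - x"

lemma mv_algebra_unit_interval: "mv_algebra {0..1} unit_oplus unit_neg 0"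
  by unfold_locales (auto simp: unit_oplus_def unit_neg_def min_def)


section \<open>MV-terms and the free MV-algebra\<close>

datatype 'v mv_term =
    Var 'v
  | Zero
  | Neg "'v mv_term"
  | Oplus "'v mv_term" "'v mv_term"

primrec mv_eval ::
  "('a \<Rightarrow> 'a \<Rightarrow> 'a) \<Rightarrow> ('a \<Rightarrow> 'a) \<Rightarrow> 'a \<Rightarrow> ('v \<Rightarrow> 'a) \<Rightarrow> 'v mv_term \<Rightarrow> 'a" where
  "mv_eval oplus neg zero v (Var i) = v i"
| "mv_eval oplus neg zero v Zero = zero"
| "mv_eval oplus neg zero v (Neg t) = neg (mv_eval oplus neg zero v t)"
| "mv_eval oplus neg zero v (Oplus s t) =
     oplus (mv_eval oplus neg zero v s) (mv_eval oplus neg zero v t)"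

lemma (in mv_algebra) mv_eval_closed:
  "range v \<subseteq> A \<Longrightarrow> mv_eval oplus neg zero v t \<in> A"
  by (induction t) (auto intro: oplus_closed neg_closed zero_closed)

text \<open>
  HOL cannot quantify over the MV-algebras of all types inside a definition, so
  \<open>mv_identity\<close> quantifies over the MV-algebras whose elements are sets of terms.
  The lemma \<open>mv_identity_holds\<close> below shows that this loses nothing: the identity then
  holds in every MV-algebra over every type.
\<close>

definition mv_identity :: "'v mv_term \<Rightarrow> 'v mv_term \<Rightarrow> bool" where
  "mv_identity s t \<longleftrightarrow>
     (\<forall>(A :: 'v mv_term set set) oplus neg zero v.
        mv_algebra A oplus neg zero \<longrightarrow> range v \<subseteq> A \<longrightarrow>
        mv_eval oplus neg zero v s = mv_eval oplus neg zero v t)"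

lemma mv_identity_holds:
  fixes A :: "'a set" and s t :: "'v mv_term"
  assumes id: "mv_identity s t" and mv: "mv_algebra A oplus neg zero" and v: "range v \<subseteq> A"
  shows "mv_eval oplus neg zero v s = mv_eval oplus neg zero v t"
proof -
  interpret mv_algebra A oplus neg zero by (rule mv)
  define e where "e = mv_eval oplus neg zero v"
  have eA: "e w \<in> A" for w unfolding e_def by (rule mv_eval_closed[OF v])
  have e_simps: "e Zero = zero" "e (Neg w) = neg (e w)" "e (Oplus w w') = oplus (e w) (e w')"
    for w w' by (simp_all add: e_def)
  define cls where "cls u = {w. e w = e u}" for u
  define rep where "rep X = (SOME w. w \<in> X)" for X :: "'v mv_term set"
  have cls_eq: "cls u = cls w \<longleftrightarrow> e u = e w" for u w
    unfolding cls_def by auto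
  have e_rep: "e (rep (cls u)) = e u" for u
  proof -
    have "rep (cls u) \<in> cls u" unfolding rep_def by (rule someI[of _ u]) (simp add: cls_def)
    then show ?thesis by (simp add: cls_def)
  qed
  define op' where "op' X Y = cls (Oplus (rep X) (rep Y))" for X Y
  define neg' where "neg' X = cls (Neg (rep X))" for X
  have op': "op' (cls u) (cls w) = cls (Oplus u w)" for u w
    by (simp add: op'_def cls_eq e_simps e_rep)
  have neg': "neg' (cls u) = cls (Neg u)" for u
    by (simp add: neg'_def cls_eq e_simps e_rep)
  have mv': "mv_algebra (range cls) op' neg' (cls Zero)"
  proof (unfold_locales, goal_cases)
    case (4 x y z) then show ?case by (elim rangeE) (simp add: op' cls_eq e_simps oplus_assoc eA)
  next
    case (5 x y)
    then obtain u w where "x = cls u" "y = cls w" by blast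
    then show ?case using oplus_comm[OF eA eA, of u w] by (simp add: op' cls_eq e_simps)
  next
    case (9 x y)
    then obtain u w where "x = cls u" "y = cls w" by blast
    then show ?case using lukasiewicz[OF eA eA, of u w] by (simp add: op' neg' cls_eq e_simps)
  qed ((elim rangeE)?; simp add: rangeI op' neg' cls_eq e_simps oplus_zero neg_neg oplus_neg_zero eA)+
  have "mv_eval op' neg' (cls Zero) (\<lambda>i. cls (Var i)) u = cls u" for u
    by (induction u) (simp_all add: op' neg')
  moreover have "mv_eval op' neg' (cls Zero) (\<lambda>i. cls (Var i)) s
      = mv_eval op' neg' (cls Zero) (\<lambda>i. cls (Var i)) t"
    by (rule id[unfolded mv_identity_def, rule_format, OF mv']) (rule image_subsetI, rule rangeI)
  ultimately show ?thesis by (simp add: cls_eq e_def)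
qed

definition mv_identity_rel :: "('v mv_term \<times> 'v mv_term) set" where
  "mv_identity_rel = {(s, t). mv_identity s t}"

lemma equiv_mv_identity_rel: "equiv UNIV mv_identity_rel"
proof (rule equivI)
  show "refl mv_identity_rel"
    by (simp add: mv_identity_rel_def mv_identity_def refl_on_def)
  show "sym mv_identity_rel"
    by (rule symI) (simp add: mv_identity_rel_def mv_identity_def)
  show "trans mv_identity_rel"
    by (rule transI) (simp add: mv_identity_rel_def mv_identity_def)
qed simp_all

text \<open>The generators of the free MV-algebra are indexed by the type \<open>'v\<close>.\<close>

definition free_mv :: "'v mv_term set set" where
  "free_mv = UNIV // mv_identity_rel"

definition term_class :: "'v mv_term \<Rightarrow> 'v mv_term set" where
  "term_class t = mv_identity_rel `` {t}"

definition class_rep :: "'v mv_term set \<Rightarrow> 'v mv_term" where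
  "class_rep a = (SOME t. t \<in> a)"

definition free_oplus :: "'v mv_term set \<Rightarrow> 'v mv_term set \<Rightarrow> 'v mv_term set" where
  "free_oplus a b = term_class (Oplus (class_rep a) (class_rep b))"

definition free_neg :: "'v mv_term set \<Rightarrow> 'v mv_term set" where
  "free_neg a = term_class (Neg (class_rep a))"

definition free_zero :: "'v mv_term set" where
  "free_zero = term_class Zero"

lemma free_mv_eq: "free_mv = range term_class"
  by (auto simp: free_mv_def term_class_def quotient_def)

lemma term_class_eq_iff: "term_class s = term_class t \<longleftrightarrow> mv_identity s t"
  using eq_equiv_class_iff[OF equiv_mv_identity_rel, of s t]
  by (simp add: term_class_def mv_identity_rel_def)

lemma class_rep_identity: "mv_identity t (class_rep (term_class t))"
proof -
  have "t \<in> term_class t"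
    by (simp add: term_class_def mv_identity_rel_def mv_identity_def)
  then have "class_rep (term_class t) \<in> term_class t"
    unfolding class_rep_def by (rule someI)
  then show ?thesis by (simp add: term_class_def mv_identity_rel_def)
qed

lemma free_oplus_term_class: "free_oplus (term_class s) (term_class t) = term_class (Oplus s t)"
  using class_rep_identity[of s] class_rep_identity[of t]
  unfolding free_oplus_def term_class_eq_iff mv_identity_def by simp

lemma free_neg_term_class: "free_neg (term_class t) = term_class (Neg t)"
  using class_rep_identity[of t]
  unfolding free_neg_def term_class_eq_iff mv_identity_def by simp

lemma mv_algebra_free_mv: "mv_algebra free_mv free_oplus free_neg free_zero"
proof -
  have assoc: "mv_identity (Oplus (Oplus r s) t) (Oplus r (Oplus s t))" for r s t :: "'v mv_term"
    unfolding mv_identity_def mv_eval.simps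
    by (intro allI impI, rule mv_algebra.oplus_assoc, assumption; erule (1) mv_algebra.mv_eval_closed)
  have comm: "mv_identity (Oplus s t) (Oplus t s)" for s t :: "'v mv_term"
    unfolding mv_identity_def mv_eval.simps
    by (intro allI impI, rule mv_algebra.oplus_comm, assumption; erule (1) mv_algebra.mv_eval_closed)
  have zero: "mv_identity (Oplus t Zero) t" for t :: "'v mv_term"
    unfolding mv_identity_def mv_eval.simps
    by (intro allI impI, rule mv_algebra.oplus_zero, assumption; erule (1) mv_algebra.mv_eval_closed)
  have neg: "mv_identity (Neg (Neg t)) t" for t :: "'v mv_term"
    unfolding mv_identity_def mv_eval.simps
    by (intro allI impI, rule mv_algebra.neg_neg, assumption; erule (1) mv_algebra.mv_eval_closed)
  have one: "mv_identity (Oplus t (Neg Zero)) (Neg Zero)" for t :: "'v mv_term"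
    unfolding mv_identity_def mv_eval.simps
    by (intro allI impI, rule mv_algebra.oplus_neg_zero, assumption; erule (1) mv_algebra.mv_eval_closed)
  have luk: "mv_identity (Oplus (Neg (Oplus (Neg s) t)) t) (Oplus (Neg (Oplus (Neg t) s)) s)" for s t :: "'v mv_term"
    unfolding mv_identity_def mv_eval.simps
    by (intro allI impI, rule mv_algebra.lukasiewicz, assumption; erule (1) mv_algebra.mv_eval_closed)
  show ?thesis
    unfolding free_mv_eq free_zero_def
    by unfold_locales
      ((elim rangeE)?; simp only: free_oplus_term_class free_neg_term_class term_class_eq_iff
        rangeI assoc comm zero neg one luk)+
qed

lemma free_mv_generated:
  "mv_eval free_oplus free_neg free_zero (\<lambda>i. term_class (Var i)) t = term_class t"
  by (induction t) (simp_all add: free_oplus_term_class free_neg_term_class free_zero_def)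

lemma free_mv_universal:
  fixes A :: "'a set" and v :: "'v \<Rightarrow> 'a"
  assumes mv: "mv_algebra A oplus neg zero" and v: "range v \<subseteq> A"
  shows "\<exists>h. h ` free_mv \<subseteq> A \<and> (\<forall>i. h (term_class (Var i)) = v i) \<and> h free_zero = zero \<and>
      (\<forall>a\<in>free_mv. h (free_neg a) = neg (h a)) \<and>
      (\<forall>a\<in>free_mv. \<forall>b\<in>free_mv. h (free_oplus a b) = oplus (h a) (h b))"
proof -
  define h where "h a = mv_eval oplus neg zero v (class_rep a)" for a
  have h: "h (term_class t) = mv_eval oplus neg zero v t" for t
    unfolding h_def by (rule mv_identity_holds[OF class_rep_identity mv v, symmetric])
  show ?thesis
    by (rule exI[of _ h])
      (auto simp: free_mv_eq h free_zero_def free_neg_term_class free_oplus_term_class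
        intro: mv_algebra.mv_eval_closed[OF mv v])
qed


section \<open>Term functions and McNaughton functions\<close>

definition unit_cube :: "(real ^ 'n) set" where
  "unit_cube = {x. \<forall>i. x $ i \<in> {0..1}}"

definition term_fun :: "'n mv_term set \<Rightarrow> real ^ 'n \<Rightarrow> real" where
  "term_fun a x = mv_eval unit_oplus unit_neg 0 (\<lambda>i. x $ i) (class_rep a)"

lemma term_fun_term_class:
  assumes "x \<in> unit_cube"
  shows "term_fun (term_class t) x = mv_eval unit_oplus unit_neg 0 (\<lambda>i. x $ i) t"
  unfolding term_fun_def
  by (rule mv_identity_holds[OF class_rep_identity mv_algebra_unit_interval, symmetric])
    (use assms in \<open>auto simp: unit_cube_def\<close>)

definition int_linear_poly :: "(real ^ 'n \<Rightarrow> real) \<Rightarrow> bool" where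
  "int_linear_poly g \<longleftrightarrow>
     (\<exists>(c0 :: int) (c :: int ^ 'n). \<forall>x. g x = of_int c0 + (\<Sum>i\<in>UNIV. of_int (c $ i) * x $ i))"

definition mcnaughton :: "(real ^ 'n \<Rightarrow> real) \<Rightarrow> bool" where
  "mcnaughton f \<longleftrightarrow>
     f ` unit_cube \<subseteq> {0..1} \<and>
     continuous_on unit_cube f \<and>
     (\<exists>(k :: nat) (g :: nat \<Rightarrow> real ^ 'n \<Rightarrow> real).
        (\<forall>j\<in>{1..k}. int_linear_poly (g j)) \<and>
        (\<forall>x\<in>unit_cube. \<exists>j\<in>{1..k}. f x = g j x))"

end

theory Submission
  imports Defs
begin

text \<open>
  Let \<open>p\<^sub>j\<close> be the truncation of \<open>g\<^sub>j\<close> to \<open>[0,1]\<close>. Following \<open>f\<close> along the segment from \<open>a\<close> to \<open>b\<close>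
  shows that some \<open>g\<^sub>j\<close> satisfies \<open>g\<^sub>j a \<le> f a\<close> and \<open>f b \<le> g\<^sub>j b\<close>, and this survives truncation.
  Hence, with \<open>S\<^sub>b = {j. f b \<le> p\<^sub>j b}\<close>, the function \<open>f\<close> is the maximum of the functions
  \<open>min\<^bsub>j \<in> S\<^sub>b\<^esub> p\<^sub>j\<close>, of which there are finitely many. Minima and maxima are MV-definable, and
  each \<open>p\<^sub>j\<close> is a term function by induction on the sum of the absolute values of its coefficients.
\<close>

section \<open>Functions on the cube given by MV-terms\<close>

text \<open>Stated with terms, so that closure properties need no class representatives; values off
  the cube are left free.\<close>

definition mv_representable :: "(real ^ 'n \<Rightarrow> real) \<Rightarrow> bool" where
  "mv_representable h \<longleftrightarrow>
     (\<exists>t. \<forall>x\<in>unit_cube. h x = mv_eval unit_oplus unit_neg 0 (\<lambda>i. x $ i) t)"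

definition clip :: "real \<Rightarrow> real" where
  "clip r = max 0 (min 1 r)"

lemma clip_mono: "r \<le> s \<Longrightarrow> clip r \<le> clip s"
  by (auto simp: clip_def)

lemma clip_ident: "r \<in> {0..1} \<Longrightarrow> clip r = r"
  by (auto simp: clip_def)

lemma mv_representable_cong:
  assumes "mv_representable h" "\<And>x. x \<in> unit_cube \<Longrightarrow> h x = h' x"
  shows "mv_representable h'"
  using assms unfolding mv_representable_def by metis

lemma mv_representable_bounds:
  assumes "mv_representable h" "x \<in> unit_cube"
  shows "0 \<le> h x" "h x \<le> 1"
proof -
  obtain t where "h x = mv_eval unit_oplus unit_neg 0 (\<lambda>i. x $ i) t"
    using assms unfolding mv_representable_def by blast
  moreover have "mv_eval unit_oplus unit_neg 0 (\<lambda>i. x $ i) t \<in> {0..1}"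
    by (rule mv_algebra.mv_eval_closed[OF mv_algebra_unit_interval])
      (use assms(2) in \<open>auto simp: unit_cube_def\<close>)
  ultimately show "0 \<le> h x" "h x \<le> 1" by auto
qed

lemma mv_representable_component: "mv_representable (\<lambda>x. x $ i)"
  unfolding mv_representable_def by (rule exI[of _ "Var i"]) simp

lemma mv_representable_0: "mv_representable (\<lambda>x. 0)"
  unfolding mv_representable_def by (rule exI[of _ Zero]) simp

lemma mv_representable_neg: "mv_representable h \<Longrightarrow> mv_representable (\<lambda>x. 1 - h x)"
  unfolding mv_representable_def by (metis mv_eval.simps(3) unit_neg_def)

lemma mv_representable_oplus:
  "mv_representable h \<Longrightarrow> mv_representable h' \<Longrightarrow> mv_representable (\<lambda>x. min 1 (h x + h' x))"
  unfolding mv_representable_def by (metis mv_eval.simps(4) unit_oplus_def)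

text \<open>De Morgan dual of the truncated sum: the Lukasiewicz conjunction \<odot>.\<close>

lemma mv_representable_odot:
  assumes "mv_representable h" "mv_representable h'"
  shows "mv_representable (\<lambda>x. max 0 (h x + h' x - 1))"
  by (rule mv_representable_cong[OF mv_representable_neg[OF mv_representable_oplus[OF
        mv_representable_neg[OF assms(1)] mv_representable_neg[OF assms(2)]]]])
    (auto simp: min_def max_def)

lemma mv_representable_max:
  assumes "mv_representable h" "mv_representable h'"
  shows "mv_representable (\<lambda>x. max (h x) (h' x))"
proof (rule mv_representable_cong)
  \<comment> \<open>This is one side of the Lukasiewicz axiom: the negated inner sum is
    \<open>max 0 (h x - h' x)\<close>, to which \<open>h' x\<close> is added back.\<close>
  show "mv_representable (\<lambda>x. min 1 ((1 - min 1 ((1 - h x) + h' x)) + h' x))"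
    by (intro mv_representable_oplus mv_representable_neg assms)
  show "min 1 ((1 - min 1 ((1 - h x) + h' x)) + h' x) = max (h x) (h' x)"
    if "x \<in> unit_cube" for x
    using mv_representable_bounds[OF assms(1) that] mv_representable_bounds[OF assms(2) that]
    by (auto simp: min_def max_def)
qed

lemma mv_representable_min:
  assumes "mv_representable h" "mv_representable h'"
  shows "mv_representable (\<lambda>x. min (h x) (h' x))"
  by (rule mv_representable_cong[OF mv_representable_neg[OF mv_representable_max[OF
        mv_representable_neg[OF assms(1)] mv_representable_neg[OF assms(2)]]]])
    (auto simp: min_def max_def)

lemma mv_representable_Max:
  assumes "finite S" "S \<noteq> {}" "\<And>s. s \<in> S \<Longrightarrow> mv_representable (h s)"
  shows "mv_representable (\<lambda>x. MAX s\<in>S. h s x)"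
  using assms by (induction S rule: finite_ne_induct) (auto intro: mv_representable_max)

lemma mv_representable_Min:
  assumes "finite S" "S \<noteq> {}" "\<And>s. s \<in> S \<Longrightarrow> mv_representable (h s)"
  shows "mv_representable (\<lambda>x. MIN s\<in>S. h s x)"
  using assms by (induction S rule: finite_ne_induct) (auto intro: mv_representable_min)

section \<open>Truncated integer affine functions\<close>

text \<open>The right side is \<open>(clip r \<oplus> y) \<odot> clip (r + 1)\<close>. For
  \<open>r \<ge> 0\<close> the second factor is 1; for \<open>-1 \<le> r \<le> 0\<close> the factors
  are \<open>y\<close> and \<open>r + 1\<close>; for \<open>r \<le> -1\<close> both sides
  vanish.\<close>

lemma clip_add:
  assumes "0 \<le> y" "y \<le> 1"
  shows "clip (r + y) = max 0 (min 1 (clip r + y) + clip (r + 1) - 1)"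
  using assms unfolding clip_def min_def max_def by auto

lemma clip_one_minus: "clip (1 - r) = 1 - clip r"
  by (auto simp: clip_def min_def max_def)

lemma mv_representable_clip_affine:
  fixes c :: "'n::finite \<Rightarrow> int"
  shows "mv_representable (\<lambda>x :: real ^ 'n. clip (of_int c0 + (\<Sum>i\<in>UNIV. of_int (c i) * x $ i)))"
proof (induction "\<Sum>i\<in>UNIV. nat \<bar>c i\<bar>" arbitrary: c c0 rule: less_induct)
  case less
  let ?R = "\<lambda>c0 c. mv_representable
    (\<lambda>x :: real ^ 'n. clip (of_int c0 + (\<Sum>i\<in>UNIV. of_int (c i) * x $ i)))"
  \<comment> \<open>Stated for every \<open>d\<close> with the same total as \<open>c\<close>, so
    that a negative coefficient of \<open>c\<close> can be treated through \<open>- c\<close>. The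
    constant must vary too, since \<open>clip_add\<close> uses both \<open>d0\<close> and
    \<open>d0 + 1\<close>.\<close>
  have pos: "?R d0 d"
    if d: "(\<Sum>i\<in>UNIV. nat \<bar>d i\<bar>) = (\<Sum>i\<in>UNIV. nat \<bar>c i\<bar>)" and i: "d i > 0"
    for d0 :: int and d :: "'n \<Rightarrow> int" and i
  proof -
    define e where "e = d(i := d i - 1)"
    have "(\<Sum>j\<in>UNIV. nat \<bar>e j\<bar>) < (\<Sum>j\<in>UNIV. nat \<bar>d j\<bar>)"
      by (rule sum_strict_mono_ex1) (use i in \<open>auto simp: e_def\<close>)
    then have IH: "?R e0 e" for e0
      using less[of e e0] d by simp
    have sum: "(\<Sum>j\<in>UNIV. of_int (d j) * x $ j) = (\<Sum>j\<in>UNIV. of_int (e j) * x $ j) + x $ i"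
      for x :: "real ^ 'n"
      by (simp add: e_def sum.remove[of UNIV i] algebra_simps)
    show ?thesis
    proof (rule mv_representable_cong[OF mv_representable_odot[OF
            mv_representable_oplus[OF IH[of d0] mv_representable_component[of i]] IH[of "d0 + 1"]]])
      fix x :: "real ^ 'n"
      assume "x \<in> unit_cube"
      then have "0 \<le> x $ i" "x $ i \<le> 1" by (auto simp: unit_cube_def)
      from clip_add[OF this, of "of_int d0 + (\<Sum>j\<in>UNIV. of_int (e j) * x $ j)"]
      show "max 0 (min 1 (clip (of_int d0 + (\<Sum>j\<in>UNIV. of_int (e j) * x $ j)) + x $ i)
          + clip (of_int (d0 + 1) + (\<Sum>j\<in>UNIV. of_int (e j) * x $ j)) - 1)
        = clip (of_int d0 + (\<Sum>j\<in>UNIV. of_int (d j) * x $ j))"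
        by (simp add: sum add_ac)
    qed
  qed
  consider "\<And>i. c i = 0" | i where "c i > 0" | i where "c i < 0"
    by (metis linorder_less_linear)
  then show ?case
  proof cases
    case 1
    \<comment> \<open>An integer constant truncates to 0 or 1.\<close>
    have "mv_representable (\<lambda>x :: real ^ 'n. 1 - 0)"
      by (rule mv_representable_neg[OF mv_representable_0])
    with mv_representable_0 show ?thesis
      by (cases "c0 \<le> 0") (simp_all add: 1 clip_def)
  next
    case 2
    then show ?thesis using pos by blast
  next
    case 3
    have "?R (1 - c0) (\<lambda>i. - c i)"
      by (rule pos) (use 3 in auto)
    from mv_representable_neg[OF this] show ?thesis
      by (simp add: sum_negf clip_one_minus[symmetric])
  qed
qed

section \<open>Crossing along a segment\<close>

text \<open>\<open>J\<close> holds the lines starting at or below \<open>\<phi> 0\<close>, and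
  \<open>P\<close> the times when the graph lies on or under one of them. Were the last time
  \<open>t0\<close> in \<open>P\<close> before 1, the graph would lie only on lines outside
  \<open>J\<close> after \<open>t0\<close>. Such a line either misses the graph near
  \<open>t0\<close> by continuity, or leaves \<open>t0\<close> with smaller slope than a line of
  \<open>J\<close> on or above the graph there, so that meeting it again would give a later time in
  \<open>P\<close>.\<close>

lemma affine_selection_crossing_interval:
  fixes \<phi> :: "real \<Rightarrow> real" and u v :: "'j \<Rightarrow> real"
  assumes I: "finite I" and cont: "continuous_on {0..1} \<phi>"
    and sel: "\<And>t. t \<in> {0..1} \<Longrightarrow> \<exists>j\<in>I. \<phi> t = u j + t * v j"
  shows "\<exists>j\<in>I. u j \<le> \<phi> 0 \<and> \<phi> 1 \<le> u j + v j"
proof (rule ccontr)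
  assume neg: "\<not> ?thesis"
  define J where "J = {j\<in>I. u j \<le> \<phi> 0}"
  define P where "P = (\<Union>j\<in>J. {t\<in>{0..1}. \<phi> t \<le> u j + t * v j})"
  have "closed P"
    unfolding P_def using I
    by (intro closed_UN ballI continuous_on_closed_Collect_le cont continuous_intros)
      (auto simp: J_def)
  moreover have "P \<subseteq> {0..1}"
    by (auto simp: P_def)
  ultimately have "compact P"
    using compact_Int_closed[OF compact_Icc, of P 0 1] by (simp add: Int_absorb1)
  \<comment> \<open>The line selected at time 0 starts exactly at \<open>\<phi> 0\<close>.\<close>
  have "0 \<in> P"
    using sel[of 0] by (auto simp: P_def J_def)
  obtain t0 where t0: "t0 \<in> P" and last: "\<And>t. t \<in> P \<Longrightarrow> t \<le> t0"
    using compact_attains_sup[OF \<open>compact P\<close>] \<open>0 \<in> P\<close> by blast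
  obtain j where j: "j \<in> J" "\<phi> t0 \<le> u j + t0 * v j" and t01: "0 \<le> t0" "t0 \<le> 1"
    using t0 by (auto simp: P_def)
  have "t0 \<noteq> 1"
    using neg j by (auto simp: J_def)
  with t01 have lt: "t0 < 1" by simp
  have "continuous_on {t0..1} \<phi>"
    using cont by (rule continuous_on_subset) (use t01 in auto)
  then have lim: "(\<phi> \<longlongrightarrow> \<phi> t0) (at_right t0)"
    using lt by (metis at_within_Icc_at_right atLeastAtMost_iff continuous_on_def less_imp_le order_refl)
  \<comment> \<open>A line starting above \<open>\<phi> 0\<close> that meets the graph at \<open>t0\<close> has crossed the line \<open>j\<close> downwards.\<close>
  have "\<forall>\<^sub>F t in at_right t0. \<phi> t \<noteq> u i + t * v i" if "i \<in> I - J" for i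
  proof (cases "u i + t0 * v i = \<phi> t0")
    case True
    have "u j < u i"
      using that j by (auto simp: J_def)
    moreover from True j have "u i + t0 * v i \<le> u j + t0 * v j" by simp
    ultimately have t0v: "t0 * v i < t0 * v j" by linarith
    with t01 have v: "v i < v j"
      by (metis mult_left_mono not_less)
    have "\<phi> t \<noteq> u i + t * v i" if "t0 < t" "t < 1" for t
    proof
      assume eq: "\<phi> t = u i + t * v i"
      have "(t - t0) * v i \<le> (t - t0) * v j"
        using that v by (intro mult_left_mono) auto
      with True j eq have "\<phi> t \<le> u j + t * v j" by (simp add: algebra_simps)
      with j that t01 have "t \<in> P" by (auto simp: P_def)
      with last that show False by fastforce
    qed
    with lt show ?thesis
      unfolding eventually_at_right_field by blast
  next
    case False
    have "((\<lambda>t. \<phi> t - (u i + t * v i)) \<longlongrightarrow> \<phi> t0 - (u i + t0 * v i)) (at_right t0)"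
      by (intro tendsto_intros lim)
    from tendsto_imp_eventually_ne[OF this, of 0] False show ?thesis by simp
  qed
  then have "\<forall>\<^sub>F t in at_right t0. \<forall>i\<in>I - J. \<phi> t \<noteq> u i + t * v i"
    using I by (intro eventually_ball_finite) auto
  moreover have "\<forall>\<^sub>F t in at_right t0. t0 < t \<and> t < 1"
    unfolding eventually_at_right_field using lt by blast
  ultimately have "\<forall>\<^sub>F t in at_right t0. (\<forall>i\<in>I - J. \<phi> t \<noteq> u i + t * v i) \<and> t0 < t \<and> t < 1"
    by (rule eventually_conj)
  then obtain t where t: "\<forall>i\<in>I - J. \<phi> t \<noteq> u i + t * v i" "t0 < t" "t < 1"
    using eventually_happens[of _ "at_right t0"] by auto
  obtain i where i: "i \<in> I" "\<phi> t = u i + t * v i"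
    using sel[of t] t t01 by auto
  with t have "i \<in> J" by blast
  with i t t01 have "t \<in> P" by (auto simp: P_def)
  with last t show False by fastforce
qed

text \<open>Convexity keeps the segment from \<open>a\<close> to \<open>b\<close> in
  \<open>K\<close>, and along it each \<open>g j\<close> is affine in the parameter, with slope
  \<open>g j b - g j a\<close>.\<close>

lemma affine_selection_crossing:
  fixes f :: "real ^ 'n \<Rightarrow> real" and g :: "'j \<Rightarrow> real ^ 'n \<Rightarrow> real"
  assumes I: "finite I" and K: "convex K" and cont: "continuous_on K f"
    and aff: "\<And>j. j \<in> I \<Longrightarrow> int_linear_poly (g j)"
    and sel: "\<And>x. x \<in> K \<Longrightarrow> \<exists>j\<in>I. f x = g j x"
    and ab: "a \<in> K" "b \<in> K"
  shows "\<exists>j\<in>I. g j a \<le> f a \<and> f b \<le> g j b"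
proof -
  define p where "p t = (1 - t) *\<^sub>R a + t *\<^sub>R b" for t
  have p: "p t \<in> K" if "t \<in> {0..1}" for t
    using convexD_alt[OF K ab, of t] that by (simp add: p_def)
  have g: "g j (p t) = g j a + t * (g j b - g j a)" if "j \<in> I" for j t
  proof -
    obtain c0 :: int and c :: "int ^ 'n"
      where "\<And>x. g j x = of_int c0 + (\<Sum>i\<in>UNIV. of_int (c $ i) * x $ i)"
      using aff[OF \<open>j \<in> I\<close>] unfolding int_linear_poly_def by blast
    then show ?thesis
      by (simp add: p_def algebra_simps sum.distrib sum_subtractf sum_distrib_left)
  qed
  have "\<exists>j\<in>I. g j a \<le> (f \<circ> p) 0 \<and> (f \<circ> p) 1 \<le> g j a + (g j b - g j a)"
  proof (rule affine_selection_crossing_interval[OF I])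
    show "continuous_on {0..1} (f \<circ> p)"
      by (rule continuous_on_compose, unfold p_def, intro continuous_intros)
        (use p in \<open>auto simp: p_def intro!: continuous_on_subset[OF cont]\<close>)
    show "\<exists>j\<in>I. (f \<circ> p) t = g j a + t * (g j b - g j a)" if "t \<in> {0..1}" for t
      using sel[OF p[OF that]] g by (metis comp_apply)
  qed
  then show ?thesis by (simp add: p_def)
qed

section \<open>Max-min form and conclusion\<close>

text \<open>The crossing index for \<open>a\<close> and \<open>b\<close> lies in the set of
  \<open>b\<close> and bounds its minimum at \<open>a\<close> by \<open>f a\<close>; the set of
  \<open>a\<close> itself attains \<open>f a\<close>. Indexing the maximum by subsets of
  \<open>I\<close> rather than by points keeps it finite.\<close>

lemma max_min_representation:
  fixes f :: "'a \<Rightarrow> 'b::linorder" and p :: "'j \<Rightarrow> 'a \<Rightarrow> 'b"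
  assumes I: "finite I"
    and cross: "\<And>a b. a \<in> K \<Longrightarrow> b \<in> K \<Longrightarrow> \<exists>j\<in>I. p j a \<le> f a \<and> f b \<le> p j b"
    and a: "a \<in> K"
  shows "f a = (MAX T\<in>(\<lambda>b. {j\<in>I. f b \<le> p j b}) ` K. MIN j\<in>T. p j a)"
proof -
  define S where "S b = {j\<in>I. f b \<le> p j b}" for b
  have fin: "finite (S ` K)"
    by (rule finite_subset[of _ "Pow I"]) (use I in \<open>auto simp: S_def\<close>)
  have finS: "finite (S b)" for b
    using I by (simp add: S_def)
  have "(MIN j\<in>S b. p j a) \<le> f a" if "b \<in> K" for b
  proof -
    obtain j where "j \<in> S b" "p j a \<le> f a"
      using cross[OF a \<open>b \<in> K\<close>] by (auto simp: S_def)
    then show ?thesis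
      using finS by (meson Min_le finite_imageI image_eqI order_trans)
  qed
  moreover have "f a \<le> (MIN j\<in>S a. p j a)"
    using cross[OF a a] finS by (subst Min_ge_iff) (auto simp: S_def)
  ultimately have "f a = (MAX T\<in>S ` K. MIN j\<in>T. p j a)"
    using a by (intro Max_eqI[symmetric] finite_imageI[OF fin])
      (auto intro!: antisym image_eqI[of _ _ "S a"])
  then show ?thesis by (simp add: S_def[abs_def])
qed

lemma mcnaughton_representable:
  fixes f :: "real ^ 'n \<Rightarrow> real"
  assumes "mcnaughton f"
  shows "mv_representable f"
proof -
  let ?K = "unit_cube :: (real ^ 'n) set"
  obtain k and g :: "nat \<Rightarrow> real ^ 'n \<Rightarrow> real"
    where range: "f ` ?K \<subseteq> {0..1}" and cont: "continuous_on ?K f"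
      and aff: "\<And>j. j \<in> {1..k} \<Longrightarrow> int_linear_poly (g j)"
      and sel: "\<And>x. x \<in> ?K \<Longrightarrow> \<exists>j\<in>{1..k}. f x = g j x"
    using assms unfolding mcnaughton_def by blast
  define p where "p j x = clip (g j x)" for j x
  have "convex ?K"
    by (rule convexI) (auto simp: unit_cube_def intro!: convex_bound_le)
  have cross: "\<exists>j\<in>{1..k}. p j a \<le> f a \<and> f b \<le> p j b" if "a \<in> ?K" "b \<in> ?K" for a b
  proof -
    obtain j where j: "j \<in> {1..k}" "g j a \<le> f a" "f b \<le> g j b"
      using affine_selection_crossing[OF _ \<open>convex ?K\<close> cont aff sel \<open>a \<in> ?K\<close> \<open>b \<in> ?K\<close>] by blast
    \<comment> \<open>Truncation fixes the values of \<open>f\<close> and is monotone, so both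
      inequalities pass from \<open>g j\<close> to \<open>p j\<close>.\<close>
    moreover have "clip (f a) = f a" "clip (f b) = f b"
      using range that by (auto intro!: clip_ident)
    ultimately show ?thesis
      unfolding p_def by (metis clip_mono)
  qed
  have rep: "mv_representable (p j)" if "j \<in> {1..k}" for j
  proof -
    obtain c0 :: int and c :: "int ^ 'n"
      where "\<And>x. g j x = of_int c0 + (\<Sum>i\<in>UNIV. of_int (c $ i) * x $ i)"
      using aff[OF \<open>j \<in> {1..k}\<close>] unfolding int_linear_poly_def by blast
    then show ?thesis
      using mv_representable_clip_affine[of c0 "\<lambda>i. c $ i"] by (simp add: p_def[abs_def])
  qed
  let ?F = "(\<lambda>b. {j\<in>{1..k}. f b \<le> p j b}) ` ?K"
  have "0 \<in> ?K" by (simp add: unit_cube_def)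
  have "mv_representable (\<lambda>x. MAX T\<in>?F. MIN j\<in>T. p j x)"
  proof (rule mv_representable_Max)
    show "finite ?F"
      by (rule finite_subset[of _ "Pow {1..k}"]) auto
    show "?F \<noteq> {}"
      using \<open>0 \<in> ?K\<close> by blast
    fix T assume T: "T \<in> ?F"
    \<comment> \<open>Crossing provides a member of every such set, so each minimum is over a
      nonempty set.\<close>
    then have "T \<subseteq> {1..k}" "T \<noteq> {}"
      using cross by blast+
    then show "mv_representable (\<lambda>x. MIN j\<in>T. p j x)"
      by (intro mv_representable_Min rep) (auto intro: finite_subset)
  qed
  then show ?thesis
    by (rule mv_representable_cong) (rule max_min_representation[OF _ cross, symmetric], auto)
qed

theorem theorem4:
  fixes f :: "real ^ 'n \<Rightarrow> real"
  assumes "mcnaughton f"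
  shows "\<exists>a \<in> (free_mv :: 'n mv_term set set). \<forall>x \<in> unit_cube. f x = term_fun a x"
proof -
  obtain t where "\<forall>x\<in>unit_cube. f x = mv_eval unit_oplus unit_neg 0 (\<lambda>i. x $ i) t"
    using mcnaughton_representable[OF assms] unfolding mv_representable_def by blast
  \<comment> \<open>On the cube, the value of \<open>term_fun\<close> does not depend on the
    representative chosen for the class of \<open>t\<close>.\<close>
  then show ?thesis
    by (intro bexI[of _ "term_class t"]) (simp_all add: term_fun_term_class free_mv_eq)
qed

end
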